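(* Let $S$ be a symmetric subset of $\mathbb{R}^d$. Suppose the observed vectors $X_1,\dots,X_N\in\mathbb{R}^d$ are obtained by adversarial corruption of at most $|\mathcal{O}|$ of the random vectors $\tilde X_1,\dots,\tilde X_N$, and that $\tilde X_1,\dots,\tilde X_N$ are i.i.d. in $\mathbb{R}^d$. Let $K\in[N]$ and suppose there are $\mu^*\in\mathbb{R}^d$ and constants $c_0>0$, $c_1>0$ such that for all $v\in S$ and all $0<r\le c_0$, $H_{N,K,v}(r)\le \frac12-c_1r$, where $$H_{N,K,v}(r)=\mathbb{P}\left[\frac{1}{\sqrt{N/K}}\sum_{i=1}^{N/K}\langle\tilde X_i-\mu^*,v\rangle>r\right].$$ Let $u>0$ and assume that $$C_0\left(\sqrt{\frac{d+1}{K}}+\sqrt{\frac uK}\right)+\frac{|\mathcal{O}|}{K}\le c_0c_1,$$ where $C_0$ is the absolute constant specified in the context. Then, with probability at least $1-\exp(-u)$, $$\|\hat\mu_S^g-\mu^*\|_S\le 2r^\diamond,\qquad r^\diamond=\frac{C_0}{c_1}\left(\sqrt{\frac{d+1}{N}}+\sqrt{\frac uN}\right)+\frac{|\mathcal{O}|}{c_1\sqrt{KN}},$$ where $\hat\mu_S^g\in\operatorname{argmin}_{\mu\in\mathbb{R}^d}g_S^*(\mu)$, with $g_S^*$ built from $X_1,\dots,X_N$ and $K$ blocks as defined in the context.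
   Context: Symmetric means $x\in S\Rightarrow -x\in S$; $\|x\|_S=\sup_{v\in S}\langle v,x\rangle$; $[N]=\{1,\dots,N\}$. Adversarial corruption: $\tilde X_1,\dots,\tilde X_N$ are independent random vectors. An adversary sees all of them and may modify up to $|\mathcal{O}|$ of them in an arbitrary way ($|\mathcal O|$ a fixed integer; the set $\mathcal{O}\subset[N]$ of modified indices and the modified values may depend arbitrarily on $(\tilde X_i)_i$). The result is $X_1,\dots,X_N$, with $X_i=\tilde X_i$ for $i\notin\mathcal{O}$. The statistician observes only $(X_i)_i$. Blocks: $[N]$ is partitioned into $K$ blocks $B_1,\dots,B_K$ of equal size $N/K$ (the partition is fixed in advance, not depending on the data), with $K+1$ divisible by $4$. Put $\bar X_k=|B_k|^{-1}\sum_{i\in B_k}X_i$. For $v\in\mathbb{R}^d$, $g(v)=\mathrm{Med}(\langle\bar X_k,v\rangle)$ is the $\frac{K+1}{2}$-th smallest of the real numbers $\langle\bar X_1,v\rangle,\dots,\langle\bar X_K,v\rangle$. The Fenchel–Legendre transform on $S$ is $g_S^*(\mu)=\sup_{v\in S}(\langle\mu,v\rangle-g(v))$, $\mu\in\mathbb{R}^d$. Constant $C_0$: an absolute constant for which the following (known) Vapnik–Chervonenkis concentration bound holds: for every $n$, all independent random vectors $Y_1,\dots,Y_n$ in $\mathbb{R}^d$, every class $\mathcal{F}$ of functions $\mathbb{R}^d\to\{0,1\}$ of finite VC dimension $VC(\mathcal F)$, and every $u>0$, with probability at least $1-\exp(-u)$, $\sup_{h\in\mathcal{F}}\frac1n\sum_{i=1}^n(h(Y_i)-\mathbb{E}h(Y_i))\le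 C_0\left(\sqrt{VC(\mathcal{F})/n}+\sqrt{u/n}\right)$. (The class of indicators of affine half-spaces of $\mathbb{R}^d$ has VC dimension $d+1$.) *)

theory Defs
  imports "HOL-Probability.Probability"
begin

definition symmetric_set :: "(real ^ 'd) set \<Rightarrow> bool" where
  "symmetric_set S \<longleftrightarrow> (\<forall>x\<in>S. - x \<in> S)"

text \<open>Suprema over \<open>S\<close> are taken in the extended reals, since \<open>S\<close> may be unbounded or empty.\<close>

definition norm_wrt :: "(real ^ 'd) set \<Rightarrow> real ^ 'd \<Rightarrow> ereal" where
  "norm_wrt S x = (SUP v\<in>S. ereal (v \<bullet> x))"

definition fenchel_legendre :: "(real ^ 'd) set \<Rightarrow> (real ^ 'd \<Rightarrow> real) \<Rightarrow> real ^ 'd \<Rightarrow> ereal" where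
  "fenchel_legendre S g \<mu> = (SUP v\<in>S. ereal (\<mu> \<bullet> v - g v))"

definition equal_blocks :: "nat \<Rightarrow> nat \<Rightarrow> (nat \<Rightarrow> nat set) \<Rightarrow> bool" where
  "equal_blocks N K B \<longleftrightarrow>
     K dvd N \<and> disjoint_family_on B {1..K} \<and> (\<Union>k\<in>{1..K}. B k) = {1..N} \<and>
     (\<forall>k\<in>{1..K}. card (B k) = N div K)"

definition block_mean :: "(nat \<Rightarrow> nat set) \<Rightarrow> (nat \<Rightarrow> real ^ 'd) \<Rightarrow> nat \<Rightarrow> real ^ 'd" where
  "block_mean B x k = (1 / real (card (B k))) *\<^sub>R (\<Sum>i\<in>B k. x i)"

text \<open>The \<open>(K + 1) / 2\<close>-th smallest (counted with multiplicity, list positions starting at 0)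
  of \<open>a 1, \<dots>, a K\<close>; meant for odd \<open>K\<close>.\<close>

definition median :: "nat \<Rightarrow> (nat \<Rightarrow> real) \<Rightarrow> real" where
  "median K a = sort (map a [1..<K + 1]) ! ((K + 1) div 2 - 1)"

definition median_of_means ::
    "nat \<Rightarrow> (nat \<Rightarrow> nat set) \<Rightarrow> (nat \<Rightarrow> real ^ 'd) \<Rightarrow> real ^ 'd \<Rightarrow> real" where
  "median_of_means K B x v = median K (\<lambda>k. block_mean B x k \<bullet> v)"

text \<open>\<open>x\<close> differs from the clean sample \<open>y\<close> in at most \<open>m\<close> of the first \<open>N\<close> indices.  Required
  at every outcome of the random experiment, this lets the modified indices and the new values
  depend on the clean sample in any way, measurable or not.\<close>

definition corrupted_sample ::
    "nat \<Rightarrow> nat \<Rightarrow> (nat \<Rightarrow> real ^ 'd) \<Rightarrow> (nat \<Rightarrow> real ^ 'd) \<Rightarrow> bool" where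
  "corrupted_sample N m y x \<longleftrightarrow>
     (\<exists>J\<subseteq>{1..N}. card J \<le> m \<and> (\<forall>i\<in>{1..N} - J. x i = y i))"

definition block_tail ::
    "'w measure \<Rightarrow> (nat \<Rightarrow> 'w \<Rightarrow> real ^ 'd) \<Rightarrow> real ^ 'd \<Rightarrow> nat \<Rightarrow> nat \<Rightarrow> real ^ 'd \<Rightarrow> real \<Rightarrow> real"
  where
  "block_tail M Xt \<mu> N K v r =
     measure M {\<omega> \<in> space M.
       1 / sqrt (real N / real K) * (\<Sum>i = 1..N div K. (Xt i \<omega> - \<mu>) \<bullet> v) > r}"

definition shatters :: "('a \<Rightarrow> real) set \<Rightarrow> 'a set \<Rightarrow> bool" where
  "shatters F A \<longleftrightarrow> (\<forall>B\<subseteq>A. \<exists>h\<in>F. {x\<in>A. h x = 1} = B)"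

definition VC_dim :: "('a \<Rightarrow> real) set \<Rightarrow> enat" where
  "VC_dim F = (SUP A\<in>{A. finite A \<and> shatters F A}. enat (card A))"

text \<open>The usual measurability requirement on the class in empirical process theory.  Without it,
  the supremum of the empirical process need not be measurable, and the concentration bound below
  fails for some classes of finite VC dimension if the continuum hypothesis holds: take
  the initial segments of a well-ordering of \<open>[0, 1]\<close> of type \<open>\<omega>\<^sub>1\<close>, and uniformly
  distributed points.\<close>

definition pointwise_measurable :: "(real ^ 'd \<Rightarrow> real) set \<Rightarrow> bool" where
  "pointwise_measurable F \<longleftrightarrow> F \<subseteq> borel_measurable borel \<and>
     (\<exists>G\<subseteq>F. countable G \<and>
        (\<forall>h\<in>F. \<exists>s::nat \<Rightarrow> real ^ 'd \<Rightarrow> real. range s \<subseteq> G \<and> (\<forall>x. (\<lambda>m. s m x) \<longlonglongrightarrow> h x)))"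

text \<open>\<open>C\<close> is an admissible constant in the Vapnik--Chervonenkis concentration bound on \<open>\<real>\<^sup>d\<close>.
  An absolute constant is one that has this property for every \<open>d\<close>.  The sample spaces range
  over the probability spaces on one fixed type, which is large enough to carry independent
  vectors \<open>Y\<^sub>1, \<dots>, Y\<^sub>n\<close> with arbitrary laws.  The positivity of \<open>C\<close> also
  follows from the second conjunct (a fair coin, a one-element class, \<open>n = u = 1\<close>).\<close>

definition VC_constant :: "'d::finite itself \<Rightarrow> real \<Rightarrow> bool" where
  "VC_constant _ C \<longleftrightarrow> 0 < C \<and>
     (\<forall>(P :: (nat \<Rightarrow> real ^ 'd) measure) (n::nat) (Y :: nat \<Rightarrow> (nat \<Rightarrow> real ^ 'd) \<Rightarrow> real ^ 'd)
        (F :: (real ^ 'd \<Rightarrow> real) set) (V::nat) (u::real).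
        prob_space P \<longrightarrow> 0 < n \<longrightarrow> prob_space.indep_vars P (\<lambda>_. borel) Y {1..n} \<longrightarrow>
        (\<forall>h\<in>F. \<forall>x. h x \<in> {0, 1}) \<longrightarrow> pointwise_measurable F \<longrightarrow> VC_dim F = enat V \<longrightarrow> 0 < u \<longrightarrow>
        measure P {\<omega> \<in> space P.
          (SUP h\<in>F. ereal (1 / real n * (\<Sum>i = 1..n. h (Y i \<omega>) - (\<integral>\<omega>'. h (Y i \<omega>') \<partial>P))))
            \<le> ereal (C * (sqrt (real V / real n) + sqrt (u / real n)))}
        \<ge> 1 - exp (- u))"

end

theory Submission
  imports Defs "HOL-Real_Asymp.Real_Asymp"
begin

text \<open>Put \<open>\<epsilon> = C0 (sqrt ((d + 1) / K) + sqrt (u / K))\<close> and choose \<open>r\<close> with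
  \<open>c1 r = \<epsilon> + m / K\<close>, which is at most \<open>c0 c1\<close> by hypothesis.  For each direction \<open>v \<in> S\<close>, the mean
  of a clean block exceeds \<open>\<mu>\<^sup>* \<bullet> v + r / sqrt (N / K)\<close> with probability at most \<open>1/2 - c1 r\<close>.  That
  event is a half-space evaluated at the block mean.  Half-spaces have Vapnik--Chervonenkis
  dimension at most \<open>d + 1\<close> (\<open>VC_dim_halfspaces\<close>), and the \<open>K\<close> block means are independent, so with
  probability at least \<open>1 - exp (- u)\<close> the proportion of clean blocks above the level is, in all
  directions at once, at most \<open>1/2 - c1 r + \<epsilon> = 1/2 - m/K\<close> (\<open>few_block_means_exceed\<close>).

  The rest is deterministic.  The adversary touches at most \<open>m\<close> blocks, so at most half of the
  observed block means exceed the level, and strictly fewer because \<open>K\<close> is odd.  Hence the median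
  does not exceed it.  By symmetry of \<open>S\<close> the median is also bounded below, that is
  \<open>\<bar>g v - \<mu>\<^sup>* \<bullet> v\<bar> \<le> r / sqrt (N / K)\<close> on \<open>S\<close> (\<open>median_of_means_close\<close>).  A minimiser of the transform
  of a function that is this close to a linear form is within twice the error of its vector
  (\<open>argmin_fenchel_legendre_close\<close>), and \<open>r / sqrt (N / K)\<close> is the rate of the theorem.

  Two technical points arise in applying the concentration bound.  It is formulated for a fixed
  sample space, so the block means are first replaced by their joint law on a product space
  (\<open>VC_concentration\<close>).  It also requires the class to be pointwise measurable, which holds because
  countably many half-spaces approximate all others pointwise (\<open>pointwise_measurable_halfspaces\<close>).\<close>

section \<open>Order statistics\<close>

lemma count_in_sorted_values:
  "length (filter P (sort (map a [1..<K + 1]))) = card {k \<in> {1..K}. P (a k)}"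
proof -
  have "mset (filter P (sort (map a [1..<K + 1]))) = mset (filter P (map a [1..<K + 1]))"
    by (simp only: mset_filter mset_sort)
  then have "length (filter P (sort (map a [1..<K + 1]))) = length (filter P (map a [1..<K + 1]))"
    by (rule mset_eq_length)
  also have "\<dots> = length (filter (P \<circ> a) [1..<K + 1])"
    by (simp only: filter_map length_map)
  also have "\<dots> = card {k \<in> {1..K}. P (a k)}"
    by (subst distinct_length_filter) (auto intro!: arg_cong[of _ _ card])
  finally show ?thesis .
qed

text \<open>If the middle entry of the sorted values exceeded \<open>c\<close>, then so would all entries after it;
  together they make up at least half of the values.  The lemma after this one is its mirror image.\<close>

lemma median_le:
  fixes a :: "nat \<Rightarrow> real"
  assumes "2 * card {k \<in> {1..K}. a k > c} < K"
  shows "median K a \<le> c"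
proof (rule ccontr)
  define xs p where "xs = sort (map a [1..<K + 1])" and "p = (K + 1) div 2 - 1"
  have xs: "sorted xs" "length xs = K" by (auto simp: xs_def)
  assume "\<not> median K a \<le> c"
  then have "xs ! p > c" by (simp add: median_def xs_def p_def)
  then have "{p..<K} \<subseteq> {i. i < length xs \<and> xs ! i > c}"
    using xs sorted_nth_mono[OF xs(1)] by fastforce
  then have "K - p \<le> length (filter (\<lambda>x. x > c) xs)"
    using card_mono[of "{i. i < length xs \<and> xs ! i > c}" "{p..<K}"] by (simp add: length_filter_conv_card)
  also have "\<dots> = card {k \<in> {1..K}. a k > c}"
    unfolding xs_def by (rule count_in_sorted_values)
  finally show False using assms by (auto simp: p_def)
qed

lemma median_ge:
  fixes a :: "nat \<Rightarrow> real"
  assumes "2 * card {k \<in> {1..K}. a k < c} < K"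
  shows "median K a \<ge> c"
proof (rule ccontr)
  define xs p where "xs = sort (map a [1..<K + 1])" and "p = (K + 1) div 2 - 1"
  have xs: "sorted xs" "length xs = K" by (auto simp: xs_def)
  have p: "p < K" using assms by (auto simp: p_def)
  assume "\<not> median K a \<ge> c"
  then have "xs ! p < c" by (simp add: median_def xs_def p_def)
  then have "{..p} \<subseteq> {i. i < length xs \<and> xs ! i < c}"
    using xs p sorted_nth_mono[OF xs(1)] by fastforce
  then have "Suc p \<le> length (filter (\<lambda>x. x < c) xs)"
    using card_mono[of "{i. i < length xs \<and> xs ! i < c}" "{..p}"] by (simp add: length_filter_conv_card)
  also have "\<dots> = card {k \<in> {1..K}. a k < c}"
    unfolding xs_def by (rule count_in_sorted_values)
  finally show False using assms by (auto simp: p_def)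
qed

section \<open>The class of half-spaces\<close>

text \<open>The half-spaces are open, so that an event of the form \<open>block mean > threshold\<close>, whose
  probability is a block tail, is a member of the class evaluated at a block mean.\<close>

definition halfspace_indicators :: "('a::real_inner \<Rightarrow> real) set" where
  "halfspace_indicators = {indicator {x. x \<bullet> v > t} | v t. True}"

lemma halfspace_indicatorI [intro]: "indicator {x. x \<bullet> v > t} \<in> halfspace_indicators"
  by (auto simp: halfspace_indicators_def)

lemma range_halfspace_indicator: "halfspace_indicators \<subseteq> {h. range h \<subseteq> {0, 1}}"
  by (auto simp: halfspace_indicators_def indicator_def)

text \<open>Radon's theorem: any \<open>d + 2\<close> points split into two parts with intersecting convex hulls.  A
  half-space cannot contain the first part and miss the second, because it and its complement are
  both convex.\<close>

lemma VC_dim_halfspaces: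
  "VC_dim (halfspace_indicators :: ('a::euclidean_space \<Rightarrow> real) set) \<le> enat (DIM('a) + 1)"
  unfolding VC_dim_def
proof (rule SUP_least, rule ccontr, clarsimp)
  fix A :: "'a set"
  assume A: "finite A" "shatters halfspace_indicators A" "\<not> card A \<le> Suc DIM('a)"
  then have "affine_dependent A"
    by (intro affine_dependent_biggerset) auto
  then obtain P Q where PQ: "P \<subseteq> A" "Q \<subseteq> A" "P \<inter> Q = {}" "convex hull P \<inter> convex hull Q \<noteq> {}"
    by (rule Radon)
  from A(2) PQ(1) obtain v t where cut: "{x \<in> A. indicator {x. x \<bullet> v > t} x = (1::real)} = P"
    unfolding shatters_def halfspace_indicators_def by blast
  have "P \<subseteq> {x. v \<bullet> x > t}" "Q \<subseteq> {x. v \<bullet> x \<le> t}"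
    using cut PQ by (auto simp: indicator_def inner_commute split: if_splits)
  then have "convex hull P \<subseteq> {x. v \<bullet> x > t}" "convex hull Q \<subseteq> {x. v \<bullet> x \<le> t}"
    by (simp_all add: hull_minimal convex_halfspace_gt convex_halfspace_le)
  with PQ(4) show False by fastforce
qed

text \<open>Half-spaces with normal vectors in a countable dense set and rational thresholds approximate
  every half-space pointwise.  The delicate points are those on the bounding hyperplane, which have
  to stay outside: the approximating thresholds therefore lie above the limit by a margin that
  tends to 0 more slowly than the error of the normal vectors.\<close>

lemma pointwise_measurable_halfspaces:
  "pointwise_measurable (halfspace_indicators :: (real ^ 'd::finite \<Rightarrow> real) set)"
proof -
  obtain D :: "(real ^ 'd) set" where D: "countable D" "\<And>U. open U \<Longrightarrow> U \<noteq> {} \<Longrightarrow> \<exists>d\<in>D. d \<in> U"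
    by (rule countable_dense_setE) blast
  define h :: "real ^ 'd \<Rightarrow> real \<Rightarrow> real ^ 'd \<Rightarrow> real" where "h v t = indicator {x. x \<bullet> v > t}" for v t
  define G where "G = (\<lambda>(w, q). h w q) ` (D \<times> \<rat>)"
  have "countable G"
    unfolding G_def using D(1) countable_rat by blast
  have "G \<subseteq> halfspace_indicators"
    by (auto simp: G_def h_def)
  have "\<exists>s. range s \<subseteq> G \<and> (\<forall>x. (\<lambda>n. s n x) \<longlonglongrightarrow> h v t x)" for v t
  proof -
    have "\<exists>w\<in>D. w \<in> ball v (1 / real (Suc n) ^ 2)" for n
      by (rule D(2)) auto
    then obtain w where w: "w n \<in> D" "dist v (w n) < 1 / real (Suc n) ^ 2" for n
      by (metis mem_ball)
    have "\<exists>q\<in>\<rat>. t + 1 / real (Suc n) < q \<and> q < t + 2 / real (Suc n)" for n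
      by (rule Rats_dense_in_real) (simp add: divide_simps)
    then obtain q where q: "q n \<in> \<rat>" "t + 1 / real (Suc n) < q n" "q n < t + 2 / real (Suc n)" for n
      by metis
    have lim0: "(\<lambda>n. 1 / real (Suc n)) \<longlonglongrightarrow> 0" "(\<lambda>n. 1 / real (Suc n) ^ 2) \<longlonglongrightarrow> 0" "(\<lambda>n. 2 / real (Suc n)) \<longlonglongrightarrow> 0"
      by real_asymp+
    have "(\<lambda>n. dist v (w n)) \<longlonglongrightarrow> 0"
      by (rule tendsto_sandwich[OF _ _ tendsto_const lim0(2)])
        (intro always_eventually allI less_imp_le[OF w(2)] zero_le_dist)+
    then have "w \<longlonglongrightarrow> v"
      by (simp only: dist_commute[of v] flip: tendsto_dist_iff)
    have "(\<lambda>n. t + 2 / real (Suc n)) \<longlonglongrightarrow> t"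
      using tendsto_add[OF tendsto_const lim0(3), of t] by simp
    moreover have "(\<lambda>n. t + 1 / real (Suc n)) \<longlonglongrightarrow> t"
      using tendsto_add[OF tendsto_const lim0(1), of t] by simp
    ultimately have "q \<longlonglongrightarrow> t"
      using q by (intro tendsto_sandwich[of "\<lambda>n. t + 1 / real (Suc n)" q _ "\<lambda>n. t + 2 / real (Suc n)"])
        (auto intro!: always_eventually less_imp_le)
    have "(\<lambda>n. h (w n) (q n) x) \<longlonglongrightarrow> h v t x" for x
    proof -
      have lim: "(\<lambda>n. x \<bullet> w n - q n) \<longlonglongrightarrow> x \<bullet> v - t"
        by (intro tendsto_intros \<open>w \<longlonglongrightarrow> v\<close> \<open>q \<longlonglongrightarrow> t\<close>)
      have "\<forall>\<^sub>F n in sequentially. h (w n) (q n) x = h v t x"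
      proof (cases "x \<bullet> v > t")
        case True
        with order_tendstoD(1)[OF lim, of 0] show ?thesis
          by (auto elim!: eventually_mono simp: h_def)
      next
        case False
        \<comment> \<open>Replacing \<open>v\<close> by \<open>w n\<close> moves the inner product by at most \<open>norm x / (n + 1)\<^sup>2\<close>, which the
          margin \<open>1 / (n + 1)\<close> of the threshold absorbs as soon as \<open>norm x \<le> n\<close>.\<close>
        have "\<forall>\<^sub>F n in sequentially. norm x \<le> real n"
          by real_asymp
        then show ?thesis
        proof eventually_elim
          case (elim n)
          have "x \<bullet> w n = x \<bullet> v + x \<bullet> (w n - v)" by (simp add: inner_diff_right)
          also have "x \<bullet> (w n - v) \<le> norm x * dist v (w n)"
            by (metis dist_commute dist_norm norm_cauchy_schwarz)
          also have "\<dots> \<le> real (Suc n) * (1 / real (Suc n) ^ 2)"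
            using elim w(2)[of n] by (intro mult_mono) auto
          also have "\<dots> = 1 / real (Suc n)" by (simp add: power2_eq_square)
          finally have "x \<bullet> w n \<le> q n" using False q(2)[of n] by linarith
          with False show ?case by (simp add: h_def)
        qed
      qed
      then show ?thesis by (rule tendsto_eventually)
    qed
    moreover have "range (\<lambda>n. h (w n) (q n)) \<subseteq> G" using w(1) q(1) by (auto simp: G_def)
    ultimately show ?thesis by blast
  qed
  then have approx: "\<forall>f\<in>halfspace_indicators. \<exists>s. range s \<subseteq> G \<and> (\<forall>x. (\<lambda>n. s n x) \<longlonglongrightarrow> f x)"
    unfolding halfspace_indicators_def h_def by blast
  moreover have "halfspace_indicators \<subseteq> borel_measurable (borel :: (real ^ 'd) measure)"
    by (auto simp: halfspace_indicators_def)
  ultimately show ?thesis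
    unfolding pointwise_measurable_def
    using \<open>countable G\<close> \<open>G \<subseteq> halfspace_indicators\<close> approx by (intro conjI exI[of _ G])
qed

section \<open>Independent and identically distributed families\<close>

context prob_space
begin

lemma indep_vars_blocks:
  assumes "indep_vars (\<lambda>_. N) X I"
    and "\<And>j. j \<in> L \<Longrightarrow> A j \<subseteq> I" "disjoint_family_on A L"
    and "\<And>j. j \<in> L \<Longrightarrow> f j \<in> measurable (Pi\<^sub>M (A j) (\<lambda>_. N)) N'"
  shows "indep_vars (\<lambda>_. N') (\<lambda>j \<omega>. f j (\<lambda>i\<in>A j. X i \<omega>)) L"
  by (rule indep_vars_compose2[OF indep_vars_restrict[OF assms(1-3)] assms(4)])

text \<open>Independent variables can be moved to their joint law on a product space, where they become
  the coordinates.  This realises independent vectors from an arbitrary sample space on the one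
  over which the assumption on the Vapnik--Chervonenkis constant quantifies.\<close>

lemma indep_vars_coordinates:
  assumes "indep_vars (\<lambda>_. N) Y I" "I \<noteq> {}"
  defines "P \<equiv> distr M (Pi\<^sub>M I (\<lambda>_. N)) (\<lambda>\<omega>. \<lambda>k\<in>I. Y k \<omega>)"
  shows "prob_space.indep_vars P (\<lambda>_. N) (\<lambda>k x. x k) I"
proof -
  have Y: "Y k \<in> measurable M N" if "k \<in> I" for k
    using assms(1) that by (simp add: indep_vars_def)
  then have YI: "(\<lambda>\<omega>. \<lambda>k\<in>I. Y k \<omega>) \<in> measurable M (Pi\<^sub>M I (\<lambda>_. N))"
    by (rule measurable_restrict)
  interpret P: prob_space P
    unfolding P_def by (rule prob_space_distr[OF YI])
  have law: "distr P N (\<lambda>x. x k) = distr M N (Y k)" if "k \<in> I" for k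
    unfolding P_def using that
    by (subst distr_distr[OF _ YI]) (auto simp: comp_def)
  have "distr P (Pi\<^sub>M I (\<lambda>_. N)) (\<lambda>x. \<lambda>k\<in>I. x k) = P"
  proof -
    have "distr P (Pi\<^sub>M I (\<lambda>_. N)) (\<lambda>x. \<lambda>k\<in>I. x k) = distr P P (\<lambda>x. x)"
      by (rule distr_cong) (auto simp: P_def space_PiM PiE_restrict)
    then show ?thesis by (simp add: distr_id2)
  qed
  also have "P = (\<Pi>\<^sub>M k\<in>I. distr M N (Y k))"
    unfolding P_def using indep_vars_iff_distr_eq_PiM'[where M' = "\<lambda>_. N", OF assms(2) Y] assms(1) by simp
  also have "\<dots> = (\<Pi>\<^sub>M k\<in>I. distr P N (\<lambda>x. x k))"
    by (rule PiM_cong) (auto simp: law)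
  finally show ?thesis
    by (subst P.indep_vars_iff_distr_eq_PiM'[OF assms(2)]) (auto simp: P_def)
qed

text \<open>A bijection between the two index sets permutes the factors of a product of equal laws, so
  the joint laws agree.  It follows that the tail of any block mean is that of the block
  \<open>{1..N div K}\<close>, in terms of which block tails are defined.\<close>

lemma distr_iid_sum_cong:
  fixes X :: "'i \<Rightarrow> 'a \<Rightarrow> 'b :: euclidean_space"
  assumes indep: "indep_vars (\<lambda>_. borel) X I"
    and ident: "\<And>i j. i \<in> I \<Longrightarrow> j \<in> I \<Longrightarrow> distr M borel (X i) = distr M borel (X j)"
    and A: "A \<subseteq> I" "A' \<subseteq> I" "finite A" "finite A'" "card A = card A'"
  shows "distr M borel (\<lambda>\<omega>. \<Sum>i\<in>A. X i \<omega>) = distr M borel (\<lambda>\<omega>. \<Sum>i\<in>A'. X i \<omega>)"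
proof (cases "A = {}")
  case True
  with A show ?thesis by simp
next
  case False
  obtain \<sigma> where \<sigma>: "bij_betw \<sigma> A A'"
    using A finite_same_card_bij by blast
  have \<sigma>A: "\<sigma> i \<in> I" if "i \<in> A" for i
    using \<sigma> A that by (auto simp: bij_betw_def)
  have X: "X i \<in> borel_measurable M" if "i \<in> I" for i
    using indep that by (simp add: indep_vars_def)
  \<comment> \<open>Reindexing a family of independent variables is grouping it into the blocks \<open>{\<sigma> i}\<close>.\<close>
  have "indep_vars (\<lambda>_. borel) (\<lambda>i \<omega>. (\<lambda>x. x (\<sigma> i)) (\<lambda>j\<in>{\<sigma> i}. X j \<omega>)) A"
    by (rule indep_vars_blocks[OF indep])
      (use \<sigma>A \<sigma> in \<open>auto simp: disjoint_family_on_def bij_betw_def inj_on_def\<close>)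
  then have indep\<sigma>: "indep_vars (\<lambda>_. borel) (\<lambda>i. X (\<sigma> i)) A"
    by simp
  have "distr M (Pi\<^sub>M A (\<lambda>_. borel)) (\<lambda>\<omega>. \<lambda>i\<in>A. X i \<omega>) = (\<Pi>\<^sub>M i\<in>A. distr M borel (X i))"
    using indep_vars_iff_distr_eq_PiM'[where M' = "\<lambda>_. borel" and X = X, OF False X]
      A(1) indep_vars_subset[OF indep A(1)] by auto
  also have "\<dots> = (\<Pi>\<^sub>M i\<in>A. distr M borel (X (\<sigma> i)))"
    by (rule PiM_cong) (use A(1) \<sigma>A ident in auto)
  also have "\<dots> = distr M (Pi\<^sub>M A (\<lambda>_. borel)) (\<lambda>\<omega>. \<lambda>i\<in>A. X (\<sigma> i) \<omega>)"
    using indep_vars_iff_distr_eq_PiM'[where M' = "\<lambda>_. borel" and X = "\<lambda>i. X (\<sigma> i)", OF False X] \<sigma>A indep\<sigma> by auto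
  finally have "distr (distr M (Pi\<^sub>M A (\<lambda>_. borel)) (\<lambda>\<omega>. \<lambda>i\<in>A. X i \<omega>)) borel (\<lambda>x. \<Sum>i\<in>A. x i) =
      distr (distr M (Pi\<^sub>M A (\<lambda>_. borel)) (\<lambda>\<omega>. \<lambda>i\<in>A. X (\<sigma> i) \<omega>)) borel (\<lambda>x. \<Sum>i\<in>A. x i)"
    by simp
  moreover have "distr (distr M (Pi\<^sub>M A (\<lambda>_. borel)) (\<lambda>\<omega>. \<lambda>i\<in>A. Z i \<omega>)) borel (\<lambda>x. \<Sum>i\<in>A. x i) =
      distr M borel (\<lambda>\<omega>. \<Sum>i\<in>A. Z i \<omega>)" if "\<And>i. i \<in> A \<Longrightarrow> Z i \<in> borel_measurable M" for Z :: "'i \<Rightarrow> 'a \<Rightarrow> 'b"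
    by (subst distr_distr) (use that in \<open>auto simp: comp_def intro!: measurable_restrict\<close>)
  ultimately have "distr M borel (\<lambda>\<omega>. \<Sum>i\<in>A. X i \<omega>) = distr M borel (\<lambda>\<omega>. \<Sum>i\<in>A. X (\<sigma> i) \<omega>)"
    using X A(1) \<sigma>A by (simp add: subset_iff)
  also have "(\<lambda>\<omega>. \<Sum>i\<in>A. X (\<sigma> i) \<omega>) = (\<lambda>\<omega>. \<Sum>i\<in>A'. X i \<omega>)"
    by (intro ext sum.reindex_bij_betw \<sigma>)
  finally show ?thesis .
qed

end

section \<open>Concentration of block means\<close>

context prob_space
begin

text \<open>The Vapnik--Chervonenkis bound for vectors on any probability space, by passing to their joint
  law, and with an upper bound for the dimension in place of its exact value.  The event is the
  preimage of the one on the product space.\<close>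

lemma VC_concentration:
  fixes Y :: "nat \<Rightarrow> 'a \<Rightarrow> real ^ 'd::finite" and F :: "(real ^ 'd \<Rightarrow> real) set"
  assumes C: "VC_constant TYPE('d) C"
    and n: "0 < n" and indep: "indep_vars (\<lambda>_. borel) Y {1..n}"
    and F: "F \<subseteq> {h. range h \<subseteq> {0, 1}}" "pointwise_measurable F" "VC_dim F \<le> enat V"
    and u: "0 < u"
  shows "\<exists>E\<in>events. prob E \<ge> 1 - exp (- u) \<and> (\<forall>\<omega>\<in>E. \<forall>h\<in>F.
    1 / real n * (\<Sum>i = 1..n. h (Y i \<omega>) - expectation (\<lambda>\<omega>'. h (Y i \<omega>')))
      \<le> C * (sqrt (real V / real n) + sqrt (u / real n)))"
proof -
  define I where "I = {1..n}"
  have Y: "Y k \<in> borel_measurable M" if "k \<in> I" for k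
    using indep that by (simp add: indep_vars_def I_def)
  define T where "T \<omega> = (\<lambda>k\<in>I. Y k \<omega>)" for \<omega>
  have T: "T \<in> measurable M (Pi\<^sub>M I (\<lambda>_. borel))"
    unfolding T_def using Y by (rule measurable_restrict)
  define P where "P = distr M (Pi\<^sub>M I (\<lambda>_. borel)) T"
  interpret P: prob_space P
    unfolding P_def by (rule prob_space_distr[OF T])
  have indepP: "P.indep_vars (\<lambda>_. borel) (\<lambda>k x. x k) I"
    unfolding P_def T_def using indep n
    by (intro indep_vars_coordinates) (auto simp: I_def)
  obtain V' where V': "VC_dim F = enat V'" "V' \<le> V"
    using F(3) by (cases "VC_dim F") auto
  define \<epsilon> where "\<epsilon> W = C * (sqrt (real W / real n) + sqrt (u / real n))" for W :: nat
  define D where "D x h = 1 / real n * (\<Sum>i = 1..n. h (x i) - (\<integral>x'. h (x' i) \<partial>P))" for x :: "nat \<Rightarrow> real ^ 'd" and h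
  define A where "A = {x \<in> space P. (SUP h\<in>F. ereal (D x h)) \<le> ereal (\<epsilon> V')}"
  have values_01: "\<forall>h\<in>F. \<forall>x. h x \<in> {0, 1}" using F(1) by blast
  have A: "P.prob A \<ge> 1 - exp (- u)"
    using C n indepP values_01 F(2) V'(1) u P.prob_space_axioms unfolding VC_constant_def A_def D_def \<epsilon>_def I_def by blast
  \<comment> \<open>The bound itself yields measurability of \<open>A\<close>: a set that is not measurable has measure 0 by
    convention, whereas \<open>1 - exp (- u)\<close> is positive.\<close>
  then have "P.prob A > 0" using u by (smt (verit) exp_less_one_iff)
  then have "A \<in> sets P" by (metis less_irrefl measure_notin_sets)
  then have A_sets: "A \<in> sets (Pi\<^sub>M I (\<lambda>_. borel))" by (simp add: P_def)
  have mean: "(\<integral>x. h (x i) \<partial>P) = expectation (\<lambda>\<omega>. h (Y i \<omega>))" if "h \<in> F" "i \<in> I" for h i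
  proof -
    have h: "h \<in> borel_measurable borel" using F(2) that by (auto simp: pointwise_measurable_def)
    have "(\<integral>x. h (x i) \<partial>P) = (\<integral>\<omega>. h (T \<omega> i) \<partial>M)"
      unfolding P_def by (rule integral_distr[OF T]) (use h that in measurable)
    with that show ?thesis by (simp add: T_def)
  qed
  define E where "E = T -` A \<inter> space M"
  have "E \<in> events" unfolding E_def by (rule measurable_sets[OF T A_sets])
  moreover have "prob E \<ge> 1 - exp (- u)"
    using A by (simp add: E_def P_def measure_distr[OF T A_sets])
  moreover have "1 / real n * (\<Sum>i = 1..n. h (Y i \<omega>) - expectation (\<lambda>\<omega>'. h (Y i \<omega>'))) \<le> \<epsilon> V"
    if "\<omega> \<in> E" "h \<in> F" for \<omega> h
  proof -
    have "ereal (D (T \<omega>) h) \<le> (SUP h\<in>F. ereal (D (T \<omega>) h))"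
      using that(2) by (rule SUP_upper)
    also have "\<dots> \<le> ereal (\<epsilon> V')" using that(1) by (simp add: E_def A_def)
    finally have "D (T \<omega>) h \<le> \<epsilon> V'" by simp
    also have "\<epsilon> V' \<le> \<epsilon> V"
      unfolding \<epsilon>_def using C V'(2) by (auto simp: VC_constant_def intro!: mult_left_mono divide_right_mono)
    also have "D (T \<omega>) h = 1 / real n * (\<Sum>i = 1..n. h (Y i \<omega>) - expectation (\<lambda>\<omega>'. h (Y i \<omega>')))"
      unfolding D_def using that(2) by (intro arg_cong2[of _ _ _ _ "(*)"] sum.cong) (auto simp: mean T_def I_def)
    finally show ?thesis .
  qed
  ultimately show ?thesis unfolding \<epsilon>_def by blast
qed

lemma indep_vars_block_means:
  fixes X :: "nat \<Rightarrow> 'a \<Rightarrow> real ^ 'd::finite"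
  assumes "indep_vars (\<lambda>_. borel) X {1..N}" "equal_blocks N K B"
  shows "indep_vars (\<lambda>_. borel) (\<lambda>k \<omega>. block_mean B (\<lambda>i. X i \<omega>) k) {1..K}"
proof -
  have "indep_vars (\<lambda>_. borel) (\<lambda>k \<omega>. block_mean B (\<lambda>i\<in>B k. X i \<omega>) k) {1..K}"
    unfolding block_mean_def using assms(2)
    by (intro indep_vars_blocks[OF assms(1)]) (auto simp: equal_blocks_def)
  then show ?thesis by (simp add: block_mean_def)
qed

text \<open>Both events say that a sum \<open>s\<close> of \<open>n = N / K\<close> clean vectors satisfies
  \<open>s \<bullet> v - n (\<mu> \<bullet> v) > r sqrt n\<close>: dividing by \<open>sqrt n\<close> gives the block tail, dividing by \<open>n\<close> the mean
  of a block.\<close>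

lemma prob_block_mean_exceeds:
  fixes X :: "nat \<Rightarrow> 'a \<Rightarrow> real ^ 'd::finite"
  assumes indep: "indep_vars (\<lambda>_. borel) X {1..N}"
    and ident: "\<And>i j. i \<in> {1..N} \<Longrightarrow> j \<in> {1..N} \<Longrightarrow> distr M borel (X i) = distr M borel (X j)"
    and B: "equal_blocks N K B" and N: "0 < N" and k: "k \<in> {1..K}"
  shows "prob {\<omega> \<in> space M. block_mean B (\<lambda>i. X i \<omega>) k \<bullet> v > \<mu> \<bullet> v + r / sqrt (real N / real K)}
    = block_tail M X \<mu> N K v r"
proof -
  define n where "n = N div K"
  have "K dvd N" "card (B k) = n" "B k \<subseteq> {1..N}"
    using B k by (auto simp: equal_blocks_def n_def)
  then have n: "real N / real K = real n" "0 < n" "finite (B k)"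
    using N by (auto simp: n_def real_of_nat_div dvd_imp_le div_greater_zero_iff intro: finite_subset dest: dvd_imp_le)
  define U where "U = {s. s \<bullet> v - real n * (\<mu> \<bullet> v) > r * sqrt (real n)}"
  have U: "U \<in> sets borel" unfolding U_def by measurable
  have X: "X i \<in> borel_measurable M" if "i \<in> {1..N}" for i
    using indep that by (simp add: indep_vars_def)
  have sub: "{1..n} \<subseteq> {1..N}" by (auto simp: n_def intro: order_trans[OF _ div_le_dividend])
  have U_iff: "1 / sqrt (real n) * (s \<bullet> v - real n * (\<mu> \<bullet> v)) > r \<longleftrightarrow> s \<in> U"
    "(1 / real n) *\<^sub>R s \<bullet> v > \<mu> \<bullet> v + r / sqrt (real n) \<longleftrightarrow> s \<in> U" for s
  proof -
    show "1 / sqrt (real n) * (s \<bullet> v - real n * (\<mu> \<bullet> v)) > r \<longleftrightarrow> s \<in> U"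
      using n(2) by (simp add: U_def pos_less_divide_eq)
    have "(1 / real n) *\<^sub>R s \<bullet> v > \<mu> \<bullet> v + r / sqrt (real n) \<longleftrightarrow>
        real n * (\<mu> \<bullet> v + r / sqrt (real n)) < s \<bullet> v"
      using n(2) by (simp add: pos_less_divide_eq mult.commute)
    also have "real n * (\<mu> \<bullet> v + r / sqrt (real n)) = real n * (\<mu> \<bullet> v) + r * sqrt (real n)"
      by (simp add: distrib_left real_div_sqrt flip: times_divide_eq_left)
    finally show "(1 / real n) *\<^sub>R s \<bullet> v > \<mu> \<bullet> v + r / sqrt (real n) \<longleftrightarrow> s \<in> U"
      by (auto simp: U_def)
  qed
  have "block_tail M X \<mu> N K v r = prob {\<omega> \<in> space M. (\<Sum>i\<in>{1..n}. X i \<omega>) \<in> U}"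
    unfolding block_tail_def n(1) U_iff(1)[symmetric]
    by (simp add: inner_diff_left sum_subtractf inner_sum_left flip: n_def)
  also have "\<dots> = measure (distr M borel (\<lambda>\<omega>. \<Sum>i\<in>{1..n}. X i \<omega>)) U"
    using X sub U by (subst measure_distr) (auto intro!: borel_measurable_sum arg_cong[where f = prob])
  also have "distr M borel (\<lambda>\<omega>. \<Sum>i\<in>{1..n}. X i \<omega>) = distr M borel (\<lambda>\<omega>. \<Sum>i\<in>B k. X i \<omega>)"
    using sub \<open>B k \<subseteq> _\<close> n \<open>card (B k) = n\<close> by (intro distr_iid_sum_cong[OF indep ident]) auto
  also have "measure \<dots> U = prob {\<omega> \<in> space M. (\<Sum>i\<in>B k. X i \<omega>) \<in> U}"
    using X \<open>B k \<subseteq> _\<close> U by (subst measure_distr) (auto intro!: borel_measurable_sum arg_cong[where f = prob])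
  also have "\<dots> = prob {\<omega> \<in> space M. block_mean B (\<lambda>i. X i \<omega>) k \<bullet> v > \<mu> \<bullet> v + r / sqrt (real N / real K)}"
    by (simp only: block_mean_def \<open>card (B k) = n\<close> n(1) U_iff(2))
  finally show ?thesis by simp
qed

text \<open>The concentration bound for half-spaces, applied to the \<open>K\<close> independent block means.  It is
  uniform in the direction, which the estimator requires since the worst direction depends on the
  data.\<close>

lemma few_block_means_exceed:
  fixes X :: "nat \<Rightarrow> 'a \<Rightarrow> real ^ 'd::finite"
  assumes C: "VC_constant TYPE('d) C" and u: "0 < u"
    and indep: "indep_vars (\<lambda>_. borel) X {1..N}"
    and ident: "\<And>i j. i \<in> {1..N} \<Longrightarrow> j \<in> {1..N} \<Longrightarrow> distr M borel (X i) = distr M borel (X j)"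
    and B: "equal_blocks N K B" and K: "0 < K" and N: "0 < N"
    and tail: "\<And>v. v \<in> S \<Longrightarrow> block_tail M X \<mu> N K v r \<le> p"
  shows "\<exists>E\<in>events. prob E \<ge> 1 - exp (- u) \<and> (\<forall>\<omega>\<in>E. \<forall>v\<in>S.
    real (card {k \<in> {1..K}. block_mean B (\<lambda>i. X i \<omega>) k \<bullet> v > \<mu> \<bullet> v + r / sqrt (real N / real K)}) / real K
      \<le> p + C * (sqrt ((real CARD('d) + 1) / real K) + sqrt (u / real K)))"
proof -
  define Y where "Y k \<omega> = block_mean B (\<lambda>i. X i \<omega>) k" for k \<omega>
  define \<epsilon> where "\<epsilon> = C * (sqrt ((real CARD('d) + 1) / real K) + sqrt (u / real K))"
  have indepY: "indep_vars (\<lambda>_. borel) Y {1..K}"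
    using indep_vars_block_means[OF indep B] by (simp add: Y_def[abs_def])
  then have Y: "Y k \<in> borel_measurable M" if "k \<in> {1..K}" for k
    using that by (simp add: indep_vars_def)
  have "VC_dim (halfspace_indicators :: (real ^ 'd \<Rightarrow> real) set) \<le> enat (CARD('d) + 1)"
    using VC_dim_halfspaces[where 'a = "real ^ 'd"] by simp
  from VC_concentration[OF C K indepY range_halfspace_indicator pointwise_measurable_halfspaces this u]
  obtain E where E: "E \<in> events" "prob E \<ge> 1 - exp (- u)"
    and conc: "\<forall>\<omega>\<in>E. \<forall>h\<in>halfspace_indicators.
      1 / real K * (\<Sum>k = 1..K. h (Y k \<omega>) - expectation (\<lambda>\<omega>'. h (Y k \<omega>'))) \<le> \<epsilon>"
    unfolding \<epsilon>_def of_nat_add of_nat_1 by blast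
  have "real (card {k \<in> {1..K}. Y k \<omega> \<bullet> v > \<mu> \<bullet> v + r / sqrt (real N / real K)}) / real K \<le> p + \<epsilon>"
    if "\<omega> \<in> E" "v \<in> S" for \<omega> v
  proof -
    define H where "H = {x. x \<bullet> v > \<mu> \<bullet> v + r / sqrt (real N / real K)}"
    have H: "H \<in> sets borel" unfolding H_def by measurable
    have mean: "expectation (\<lambda>\<omega>'. indicator H (Y k \<omega>')) = block_tail M X \<mu> N K v r" if "k \<in> {1..K}" for k
    proof -
      have "expectation (\<lambda>\<omega>'. indicator H (Y k \<omega>')) = expectation (indicator (Y k -` H \<inter> space M))"
        by (rule Bochner_Integration.integral_cong) (auto simp: indicator_def)
      also have "\<dots> = prob {\<omega>' \<in> space M. Y k \<omega>' \<in> H}"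
        using measurable_sets[OF Y[OF that] H] by (auto intro!: arg_cong[where f = prob])
      finally show ?thesis
        using prob_block_mean_exceeds[OF indep ident B N that, of \<mu> v r] by (simp add: H_def Y_def)
    qed
    have "(\<Sum>k = 1..K. indicator H (Y k \<omega>) :: real) = real (card {k \<in> {1..K}. Y k \<omega> \<in> H})"
      by (simp add: indicator_def sum.If_cases Int_def)
    then have "(\<Sum>k = 1..K. indicator H (Y k \<omega>) - expectation (\<lambda>\<omega>'. indicator H (Y k \<omega>'))) =
        real (card {k \<in> {1..K}. Y k \<omega> \<in> H}) - real K * block_tail M X \<mu> N K v r"
      by (simp add: sum_subtractf mean)
    moreover have "indicator H \<in> halfspace_indicators"
      unfolding H_def by (rule halfspace_indicatorI)
    ultimately have "1 / real K * (real (card {k \<in> {1..K}. Y k \<omega> \<in> H}) - real K * block_tail M X \<mu> N K v r) \<le> \<epsilon>"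
      using bspec[OF bspec[OF conc \<open>\<omega> \<in> E\<close>], of "indicator H"] by simp
    then have "real (card {k \<in> {1..K}. Y k \<omega> \<in> H}) / real K \<le> block_tail M X \<mu> N K v r + \<epsilon>"
      using K by (simp add: right_diff_distrib)
    then show ?thesis using tail[OF \<open>v \<in> S\<close>] by (simp add: H_def)
  qed
  with E show ?thesis unfolding Y_def \<epsilon>_def by blast
qed

end

section \<open>Medians of means of corrupted samples\<close>

text \<open>Picking a point of \<open>J\<close> in each block that meets \<open>J\<close> is injective, as the blocks are disjoint.
  Hence \<open>m\<close> corrupted vectors spoil at most \<open>m\<close> block means.\<close>

lemma card_blocks_hit:
  fixes B :: "nat \<Rightarrow> nat set"
  assumes "disjoint_family_on B I" "finite J"
  shows "card {k \<in> I. B k \<inter> J \<noteq> {}} \<le> card J"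
proof -
  define f where "f k = (SOME i. i \<in> B k \<inter> J)" for k
  have f: "f k \<in> B k \<inter> J" if "B k \<inter> J \<noteq> {}" for k
    unfolding f_def using that some_in_eq[of "B k \<inter> J"] by blast
  have "inj_on f {k \<in> I. B k \<inter> J \<noteq> {}}"
  proof (rule inj_onI)
    fix k l assume kl: "k \<in> {k \<in> I. B k \<inter> J \<noteq> {}}" "l \<in> {k \<in> I. B k \<inter> J \<noteq> {}}" "f k = f l"
    with f[of k] f[of l] have "f k \<in> B k \<inter> B l" by simp
    with kl assms(1) show "k = l" unfolding disjoint_family_on_def by blast
  qed
  moreover have "f ` {k \<in> I. B k \<inter> J \<noteq> {}} \<subseteq> J" using f by blast
  ultimately show ?thesis using assms(2) by (intro card_inj_on_le)
qed

lemma card_corrupted_block_means: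
  assumes "corrupted_sample N m y x" "equal_blocks N K B"
  shows "card {k \<in> {1..K}. block_mean B x k \<noteq> block_mean B y k} \<le> m"
proof -
  obtain J where J: "J \<subseteq> {1..N}" "card J \<le> m" "\<And>i. i \<in> {1..N} - J \<Longrightarrow> x i = y i"
    using assms(1) by (auto simp: corrupted_sample_def)
  have "block_mean B x k = block_mean B y k" if "k \<in> {1..K}" "B k \<inter> J = {}" for k
  proof -
    have "B k \<subseteq> {1..N}"
      using assms(2) that(1) by (auto simp: equal_blocks_def)
    then have "(\<Sum>i\<in>B k. x i) = (\<Sum>i\<in>B k. y i)"
      using that(2) by (intro sum.cong J(3)) auto
    then show ?thesis by (simp add: block_mean_def)
  qed
  then have "{k \<in> {1..K}. block_mean B x k \<noteq> block_mean B y k} \<subseteq> {k \<in> {1..K}. B k \<inter> J \<noteq> {}}"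
    by auto
  then have "card {k \<in> {1..K}. block_mean B x k \<noteq> block_mean B y k} \<le> card {k \<in> {1..K}. B k \<inter> J \<noteq> {}}"
    by (intro card_mono) auto
  also have "\<dots> \<le> card J"
    using assms(2) finite_subset[OF J(1)] by (intro card_blocks_hit) (auto simp: equal_blocks_def)
  finally show ?thesis using J(2) by simp
qed

text \<open>If, in every direction of \<open>S\<close>, fewer than half of the blocks exceed the level even after \<open>m\<close>
  spoilt blocks are added to those that do, then the median does not exceed it.  Symmetry of
  \<open>S\<close> turns this upper bound in the direction \<open>- v\<close> into the lower bound in the direction \<open>v\<close>.\<close>

lemma median_of_means_close:
  assumes S: "symmetric_set S"
    and corrupted: "corrupted_sample N m y x" "equal_blocks N K B"
    and few: "\<And>v. v \<in> S \<Longrightarrow> 2 * (card {k \<in> {1..K}. block_mean B y k \<bullet> v > \<mu> \<bullet> v + r} + m) < K"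
    and v: "v \<in> S"
  shows "\<bar>median_of_means K B x v - \<mu> \<bullet> v\<bar> \<le> r"
proof -
  have few_x: "2 * card {k \<in> {1..K}. block_mean B x k \<bullet> w > \<mu> \<bullet> w + r} < K" if "w \<in> S" for w
  proof -
    have "card {k \<in> {1..K}. block_mean B x k \<bullet> w > \<mu> \<bullet> w + r} \<le>
        card ({k \<in> {1..K}. block_mean B y k \<bullet> w > \<mu> \<bullet> w + r} \<union> {k \<in> {1..K}. block_mean B x k \<noteq> block_mean B y k})"
      by (intro card_mono) auto
    also have "\<dots> \<le> card {k \<in> {1..K}. block_mean B y k \<bullet> w > \<mu> \<bullet> w + r} + m"
      using card_corrupted_block_means[OF corrupted] by (intro order_trans[OF card_Un_le]) simp
    finally show ?thesis using few[OF that] by simp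
  qed
  have "median_of_means K B x v \<le> \<mu> \<bullet> v + r"
    unfolding median_of_means_def using few_x[OF v] by (rule median_le)
  moreover have "median_of_means K B x v \<ge> \<mu> \<bullet> v - r"
    unfolding median_of_means_def
  proof (rule median_ge)
    have "- v \<in> S" using S v by (simp add: symmetric_set_def)
    have "{k \<in> {1..K}. block_mean B x k \<bullet> v < \<mu> \<bullet> v - r} =
        {k \<in> {1..K}. block_mean B x k \<bullet> (- v) > \<mu> \<bullet> (- v) + r}"
      by (auto simp: algebra_simps)
    with few_x[OF \<open>- v \<in> S\<close>]
    show "2 * card {k \<in> {1..K}. block_mean B x k \<bullet> v < \<mu> \<bullet> v - r} < K" by simp
  qed
  ultimately show ?thesis by linarith
qed

section \<open>Error of the estimator\<close>

text \<open>The hypothesis says that \<open>g\<close> is within \<open>r\<close> of the linear form \<open>v \<mapsto> \<mu> \<bullet> v\<close> on \<open>S\<close>, hence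
  \<open>g\<^sup>*(\<mu>) \<le> r\<close>.  A minimiser has a value of \<open>g\<^sup>*\<close> that is no larger, so its own linear form
  exceeds \<open>g\<close> by at most \<open>r\<close>, and \<open>g\<close> exceeds that of \<open>\<mu>\<close> by at most \<open>r\<close>.\<close>

lemma argmin_fenchel_legendre_close:
  assumes argmin: "is_arg_min (fenchel_legendre S g) (\<lambda>_. True) \<mu>hat"
    and close: "\<And>v. v \<in> S \<Longrightarrow> \<bar>g v - \<mu> \<bullet> v\<bar> \<le> r"
  shows "norm_wrt S (\<mu>hat - \<mu>) \<le> ereal (2 * r)"
  unfolding norm_wrt_def
proof (rule SUP_least)
  fix v assume v: "v \<in> S"
  have "ereal (\<mu>hat \<bullet> v - g v) \<le> fenchel_legendre S g \<mu>hat"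
    unfolding fenchel_legendre_def using v by (rule SUP_upper)
  also have "\<dots> \<le> fenchel_legendre S g \<mu>"
    using argmin by (auto simp: is_arg_min_def not_less)
  also have "\<dots> \<le> ereal r"
    unfolding fenchel_legendre_def using close by (force intro!: SUP_least)
  finally show "ereal (v \<bullet> (\<mu>hat - \<mu>)) \<le> ereal (2 * r)"
    using close[OF v] by (simp add: inner_diff_right inner_commute[of v])
qed

theorem theorem6:
  fixes M :: "'w measure"
    and Xt X :: "nat \<Rightarrow> 'w \<Rightarrow> real ^ 'd::finite"
    and S :: "(real ^ 'd) set"
    and \<mu>star :: "real ^ 'd"
    and B :: "nat \<Rightarrow> nat set"
    and N K m :: nat
    and c0 c1 C0 u :: real
  assumes "prob_space M"
    and "symmetric_set S"
    and "prob_space.indep_vars M (\<lambda>_. borel) Xt {1..N}"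
    and "\<And>i j. i \<in> {1..N} \<Longrightarrow> j \<in> {1..N} \<Longrightarrow> distr M borel (Xt i) = distr M borel (Xt j)"
    and "\<And>\<omega>. \<omega> \<in> space M \<Longrightarrow> corrupted_sample N m (\<lambda>i. Xt i \<omega>) (\<lambda>i. X i \<omega>)"
    and "K \<in> {1..N}"
    and "4 dvd K + 1"
    and "equal_blocks N K B"
    and "0 < c0" and "0 < c1"
    and "\<And>v r. v \<in> S \<Longrightarrow> 0 < r \<Longrightarrow> r \<le> c0 \<Longrightarrow> block_tail M Xt \<mu>star N K v r \<le> 1 / 2 - c1 * r"
    and "VC_constant TYPE('d) C0"
    and "0 < u"
    and "C0 * (sqrt ((real CARD('d) + 1) / real K) + sqrt (u / real K)) + real m / real K \<le> c0 * c1"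
  shows "\<exists>E \<in> sets M. measure M E \<ge> 1 - exp (- u) \<and>
    (\<forall>\<omega>\<in>E. \<forall>\<mu>hat.
      is_arg_min (fenchel_legendre S (median_of_means K B (\<lambda>i. X i \<omega>))) (\<lambda>_. True) \<mu>hat \<longrightarrow>
      norm_wrt S (\<mu>hat - \<mu>star) \<le>
        ereal (2 * (C0 / c1 * (sqrt ((real CARD('d) + 1) / real N) + sqrt (u / real N))
                    + real m / (c1 * sqrt (real K * real N)))))"
proof -
  interpret prob_space M by fact
  define \<epsilon> where "\<epsilon> = C0 * (sqrt ((real CARD('d) + 1) / real K) + sqrt (u / real K))"
  define r where "r = (\<epsilon> + real m / real K) / c1"
  \<comment> \<open>\<open>r\<close> is measured in the normalisation \<open>sqrt (N / K)\<close> of the block tails; \<open>r'\<close> is half the bound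
    that is claimed.\<close>
  define r' where "r' = r / sqrt (real N / real K)"
  have K: "0 < K" "0 < N" using assms(6) by auto
  have "odd K" using assms(7) by presburger
  have "0 < \<epsilon>"
    using assms(12) K assms(13) unfolding \<epsilon>_def VC_constant_def
    by (intro mult_pos_pos add_pos_pos) (auto intro!: divide_pos_pos)
  then have r: "0 < r" "r \<le> c0" "c1 * r = \<epsilon> + real m / real K"
    using assms(10,14) by (auto simp: r_def \<epsilon>_def[symmetric] pos_divide_le_eq intro!: divide_pos_pos add_pos_nonneg)
  have "\<exists>E\<in>events. prob E \<ge> 1 - exp (- u) \<and> (\<forall>\<omega>\<in>E. \<forall>v\<in>S.
      real (card {k \<in> {1..K}. block_mean B (\<lambda>i. Xt i \<omega>) k \<bullet> v > \<mu>star \<bullet> v + r'}) / real K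
        \<le> 1 / 2 - c1 * r + \<epsilon>)"
    unfolding \<epsilon>_def r'_def
    by (rule few_block_means_exceed[OF assms(12,13,3) _ assms(8) K])
      (erule (1) assms(4), erule assms(11)[OF _ r(1,2)])
  then obtain E where E: "E \<in> events" "prob E \<ge> 1 - exp (- u)"
    and few: "\<forall>\<omega>\<in>E. \<forall>v\<in>S.
      real (card {k \<in> {1..K}. block_mean B (\<lambda>i. Xt i \<omega>) k \<bullet> v > \<mu>star \<bullet> v + r'}) / real K
        \<le> 1 / 2 - c1 * r + \<epsilon>"
    by blast
  have "norm_wrt S (\<mu>hat - \<mu>star) \<le> ereal (2 * r')"
    if \<omega>: "\<omega> \<in> E" and argmin: "is_arg_min (fenchel_legendre S (median_of_means K B (\<lambda>i. X i \<omega>))) (\<lambda>_. True) \<mu>hat"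
    for \<omega> \<mu>hat
  proof (rule argmin_fenchel_legendre_close[OF argmin])
    have "\<omega> \<in> space M" using \<omega> E(1) sets.sets_into_space by blast
    have "2 * (card {k \<in> {1..K}. block_mean B (\<lambda>i. Xt i \<omega>) k \<bullet> v > \<mu>star \<bullet> v + r'} + m) < K" if "v \<in> S" for v
    proof -
      let ?c = "card {k \<in> {1..K}. block_mean B (\<lambda>i. Xt i \<omega>) k \<bullet> v > \<mu>star \<bullet> v + r'}"
      have "real ?c / real K \<le> 1 / 2 - real m / real K"
        using bspec[OF bspec[OF few \<omega>] that] r(3) by simp
      then have "real (2 * (?c + m)) \<le> real K"
        using K by (simp add: field_simps)
      then have "2 * (?c + m) \<le> K" by (simp only: of_nat_le_iff)
      \<comment> \<open>The bound only says that at most half of the blocks exceed the level; parity makes it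
        strictly fewer than half.\<close>
      moreover have "2 * (?c + m) \<noteq> K" using \<open>odd K\<close> by (metis dvd_triv_left)
      ultimately show ?thesis by linarith
    qed
    then show "\<bar>median_of_means K B (\<lambda>i. X i \<omega>) v - \<mu>star \<bullet> v\<bar> \<le> r'" if "v \<in> S" for v
      using that by (rule median_of_means_close[OF assms(2) assms(5)[OF \<open>\<omega> \<in> space M\<close>] assms(8)])
  qed
  moreover have "r' = C0 / c1 * (sqrt ((real CARD('d) + 1) / real N) + sqrt (u / real N))
      + real m / (c1 * sqrt (real K * real N))"
  proof -
    have rescale: "sqrt (a / real K) / sqrt (real N / real K) = sqrt (a / real N)" for a
      using K by (simp flip: real_sqrt_divide)
    have "real K * sqrt (real N / real K) = sqrt (real K * real N)"
      using K by (simp add: real_sqrt_divide real_sqrt_mult field_simps)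
    then have m: "real m / real K / sqrt (real N / real K) = real m / sqrt (real K * real N)"
      by simp
    have "r' = (C0 * (sqrt ((real CARD('d) + 1) / real K) / sqrt (real N / real K) + sqrt (u / real K) / sqrt (real N / real K))
        + real m / real K / sqrt (real N / real K)) / c1"
      by (simp add: r'_def r_def \<epsilon>_def add_divide_distrib distrib_left mult.commute)
    then show ?thesis unfolding rescale m by (simp add: add_divide_distrib mult.commute)
  qed
  ultimately show ?thesis using E by auto
qed

end
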